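(* Let $k\ge1$, $g\ge1$, $r\ge1$, $n\ge1$ be integers, $p\in(0,1)$, $q=1-p$, and put $\nu=n-(r-1)(g-1)$. Let $\tilde p_{n,r}$ be the probability that a random variable with the Type II negative binomial distribution $\mathrm{NB}_{\rm II}(k,g,r)$ of order $k$ with gap $g$ equals $n$. Then $$\tilde p_{n,r}=\sum_{m=r}^{\left\lfloor\frac{\nu+1}{k+1}\right\rfloor}(-1)^{m-r}\binom{m-1}{r-1}p^{mk}q^{m-1}\left[\binom{\nu-mk}{m-1}-p\binom{\nu-mk-1}{m-1}\right].$$
   Context: Convention: $\binom{a}{b}=0$ whenever $a<b$ (including negative $a$, e.g. $\binom{-1}{0}=0$), and a sum whose upper limit is smaller than its lower limit is zero. Consider an infinite sequence of independent trials, each $S$ (success) with probability $p$ or $F$ (failure) with probability $q=1-p$. The success runs (of order $k$ with gap $g$) are defined inductively: the first success run is the first maximal run of at least $k$ consecutive successes; if the $j$-th success run terminates at trial $m$ (i.e. $m$ is its last success and trial $m+1$ is a failure), then the $(j+1)$-th success run is the first run of at least $k$ consecutive successes which begins later than trial $m+g$, taken maximal among runs beginning later than trial $m+g$. The distribution $\mathrm{NB}_{\rm II}(k,g,r)$ is the distribution of the number of trials needed until the $r$-th success run first attains length $k$, i.e. of the index of the $k$-th success trial of the $r$-th success run. *)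

theory Defs
  imports "HOL-Probability.Probability"
begin

text \<open>A realisation of the trials is a function \<open>\<omega> :: nat \<Rightarrow> bool\<close>, where \<open>\<omega> i\<close> means that trial \<open>i\<close>
  is a success. Trials are numbered from 1; \<open>\<omega> 0\<close> is irrelevant to everything below.\<close>

text \<open>At trial \<open>s\<close> there begins a run of at least \<open>k\<close> successes that is maximal among the runs
  beginning later than trial \<open>t\<close>. If \<open>s = t + 1\<close>, trial \<open>t\<close> itself may be a success.\<close>

definition long_run_begins :: "nat \<Rightarrow> (nat \<Rightarrow> bool) \<Rightarrow> nat \<Rightarrow> nat \<Rightarrow> bool" where
  "long_run_begins k \<omega> t s \<longleftrightarrow>
     t < s \<and> (\<forall>i\<in>{s..<s + k}. \<omega> i) \<and> (s = t + 1 \<or> \<not> \<omega> (s - 1))"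

definition first_long_run_begins :: "nat \<Rightarrow> (nat \<Rightarrow> bool) \<Rightarrow> nat \<Rightarrow> nat \<Rightarrow> bool" where
  "first_long_run_begins k \<omega> t s \<longleftrightarrow>
     long_run_begins k \<omega> t s \<and> (\<forall>s'. long_run_begins k \<omega> t s' \<longrightarrow> s \<le> s')"

definition run_terminates :: "(nat \<Rightarrow> bool) \<Rightarrow> nat \<Rightarrow> nat \<Rightarrow> bool" where
  "run_terminates \<omega> s m \<longleftrightarrow> s \<le> m \<and> (\<forall>i\<in>{s..m}. \<omega> i) \<and> \<not> \<omega> (m + 1)"

text \<open>\<open>success_run_begins k g \<omega> j s\<close>: the \<open>j\<close>-th success run of order \<open>k\<close> with gap \<open>g\<close> exists and
  begins at trial \<open>s\<close>, for \<open>j \<ge> 1\<close>.\<close>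

inductive success_run_begins :: "nat \<Rightarrow> nat \<Rightarrow> (nat \<Rightarrow> bool) \<Rightarrow> nat \<Rightarrow> nat \<Rightarrow> bool"
  for k g :: nat and \<omega> :: "nat \<Rightarrow> bool" where
  first: "first_long_run_begins k \<omega> 0 s \<Longrightarrow> success_run_begins k g \<omega> 1 s"
| next_run: "success_run_begins k g \<omega> j s \<Longrightarrow> run_terminates \<omega> s m \<Longrightarrow>
    first_long_run_begins k \<omega> (m + g) s' \<Longrightarrow> success_run_begins k g \<omega> (j + 1) s'"

text \<open>There is at most one such \<open>s\<close>, and the \<open>k\<close>-th success trial of that run is \<open>s + k - 1\<close>.
  The infimum is \<open>\<infinity>\<close> if there is no \<open>r\<close>-th success run.\<close>

definition waiting_time :: "nat \<Rightarrow> nat \<Rightarrow> nat \<Rightarrow> (nat \<Rightarrow> bool) \<Rightarrow> enat" where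
  "waiting_time k g r \<omega> = (INF s\<in>{s. success_run_begins k g \<omega> r s}. enat (s + k - 1))"

definition bernoulli_trials :: "real \<Rightarrow> (nat \<Rightarrow> bool) measure" where
  "bernoulli_trials p = (\<Pi>\<^sub>M i\<in>{1..}. measure_pmf (bernoulli_pmf p))"

definition NB_II :: "real \<Rightarrow> nat \<Rightarrow> nat \<Rightarrow> nat \<Rightarrow> enat measure" where
  "NB_II p k g r = distr (bernoulli_trials p) (count_space UNIV) (waiting_time k g r)"

text \<open>The binomial coefficient with the convention that it vanishes whenever \<open>a < b\<close>, including
  negative \<open>a\<close>; unlike \<open>gchoose\<close>, it is 0 for \<open>a = -1\<close>, \<open>b = 0\<close>.\<close>

definition binom :: "int \<Rightarrow> nat \<Rightarrow> nat" where
  "binom a b = (if a < int b then 0 else nat a choose b)"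

end

(* A finite automaton, reading one trial at a time, recognises the words of length n on which the
   waiting time equals n. Conditioning on the first letter turns the waiting-time probabilities
   into linear equations between generating functions. With D = 1 - X + q p^k X^(k+1) and F_r the
   generating function for r runs they read D F_1 = (1 - p X) (p X)^k and
   D F_(r+1) = (p X)^k q X^g F_r. The closed form is then the coefficient extraction from D^(-r),
   where D = (1 - X) (1 - Z) with Z = - q p^k X^(k+1) / (1 - X). *)

theory Submission
  imports Defs "HOL-Computational_Algebra.Formal_Power_Series"
begin

unbundle no vec_syntax
unbundle fps_syntax

text \<open>Write P = p X and Q = q X. Before the current run attains length k, a failure after i <
  k successes sends the automaton back to state 0, and these returns contribute Q (1 + P + ... +
  P^(k-1)). Subtracting this from 1 and clearing the denominator 1 - P gives 1 - P - Q (1 - P^k),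
  which is D because P + Q = X. Clearing also puts a factor 1 - P into the numerator. Leaving state
  k takes any number of further successes, a failure and g - 1 free trials, with series q X^g / (1 -
  P), so that factor cancels for every run but the last. The one survivor, 1 - p X, is why the
  formula has a difference of two binomials. The numerator starts at X^s with s = k r + g (r - 1),
  and nu + 1 = n - s + (k + 1) r, so the term with Z^i is the summand m = r + i. On the side of the
  runs the obstacle is direction: their definition appends a run at the end and keeps the origin
  fixed, whereas an automaton consumes the first run and restarts from a new origin.\<close>

text \<open>In \<open>completes k g r c w\<close>, \<open>r\<close> counts the runs still to come, including the current one. The state
  \<open>c < k\<close> is the number of successes read since the last failure, and \<open>c = k\<close> means that the current
  run has attained length \<open>k\<close> but has not terminated. The \<open>g - 1\<close> trials that follow the terminating
  failure are skipped.\<close>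

fun completes :: "nat \<Rightarrow> nat \<Rightarrow> nat \<Rightarrow> nat \<Rightarrow> bool list \<Rightarrow> bool" where
  "completes k g r c [] \<longleftrightarrow> r = 1 \<and> c = k"
| "completes k g r c (x # w) \<longleftrightarrow>
     (if c < k then completes k g r (if x then Suc c else 0) w
      else r \<noteq> 1 \<and>
        (if x then completes k g r c w
         else g - 1 \<le> length w \<and> completes k g (r - 1) 0 (drop (g - 1) w)))"

section \<open>Success runs counted from an arbitrary origin\<close>

inductive run_begins_after :: "nat \<Rightarrow> nat \<Rightarrow> (nat \<Rightarrow> bool) \<Rightarrow> nat \<Rightarrow> nat \<Rightarrow> nat \<Rightarrow> bool"
  for k g :: nat and \<omega> :: "nat \<Rightarrow> bool" where
  first: "first_long_run_begins k \<omega> t s \<Longrightarrow> run_begins_after k g \<omega> t 1 s"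
| later: "first_long_run_begins k \<omega> t s \<Longrightarrow> run_terminates \<omega> s m \<Longrightarrow>
    run_begins_after k g \<omega> (m + g) j s' \<Longrightarrow> run_begins_after k g \<omega> t (j + 1) s'"

lemma first_long_run_begins_unique:
  "first_long_run_begins k \<omega> t s \<Longrightarrow> first_long_run_begins k \<omega> t s' \<Longrightarrow> s = s'"
  unfolding first_long_run_begins_def by (meson le_antisym)

lemma run_terminates_unique:
  assumes "run_terminates \<omega> s m" "run_terminates \<omega> s m'"
  shows "m = m'"
proof (rule linorder_cases[of m m'])
  assume "m < m'"
  then have "m + 1 \<in> {s..m'}" using assms by (auto simp: run_terminates_def)
  then show ?thesis using assms unfolding run_terminates_def by blast
next
  assume "m' < m"
  then have "m' + 1 \<in> {s..m}" using assms by (auto simp: run_terminates_def)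
  then show ?thesis using assms unfolding run_terminates_def by blast
qed

lemma run_begins_after_pos: "run_begins_after k g \<omega> t r s \<Longrightarrow> 0 < r"
  by (erule run_begins_after.cases) auto

lemma run_begins_after_1_iff:
  "run_begins_after k g \<omega> t 1 s \<longleftrightarrow> first_long_run_begins k \<omega> t s"
proof
  assume "run_begins_after k g \<omega> t 1 s"
  then show "first_long_run_begins k \<omega> t s"
    by (cases rule: run_begins_after.cases) (auto dest: run_begins_after_pos)
qed (rule first)

lemma run_begins_after_Suc_iff:
  assumes "0 < r"
  shows "run_begins_after k g \<omega> t (Suc r) s' \<longleftrightarrow>
    (\<exists>s m. first_long_run_begins k \<omega> t s \<and> run_terminates \<omega> s m \<and>
       run_begins_after k g \<omega> (m + g) r s')"
proof
  assume "run_begins_after k g \<omega> t (Suc r) s'"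
  then show "\<exists>s m. first_long_run_begins k \<omega> t s \<and> run_terminates \<omega> s m \<and>
       run_begins_after k g \<omega> (m + g) r s'"
    using assms by (cases rule: run_begins_after.cases) auto
next
  assume "\<exists>s m. first_long_run_begins k \<omega> t s \<and> run_terminates \<omega> s m \<and>
       run_begins_after k g \<omega> (m + g) r s'"
  then show "run_begins_after k g \<omega> t (Suc r) s'"
    using later[of k \<omega> t _ _ g r s'] by auto
qed

lemma run_begins_after_unique:
  "run_begins_after k g \<omega> t r s \<Longrightarrow> run_begins_after k g \<omega> t r s' \<Longrightarrow> s = s'"
proof (induction t r s arbitrary: s' rule: run_begins_after.induct)
  case (first t s)
  then show ?case
    using first_long_run_begins_unique run_begins_after_1_iff by blast
next
  case (later t s m j s2)
  have "0 < j" using later.hyps(3) by (rule run_begins_after_pos)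
  then obtain s1 m1 where *: "first_long_run_begins k \<omega> t s1" "run_terminates \<omega> s1 m1"
      "run_begins_after k g \<omega> (m1 + g) j s'"
    using later.prems run_begins_after_Suc_iff by (metis Suc_eq_plus1)
  have "s1 = s" using * later.hyps first_long_run_begins_unique by blast
  then have "m1 = m" using * later.hyps run_terminates_unique by blast
  then show ?case using * later.IH by blast
qed

lemma run_begins_after_snoc:
  "run_begins_after k g \<omega> t j s \<Longrightarrow> run_terminates \<omega> s m \<Longrightarrow>
    first_long_run_begins k \<omega> (m + g) s' \<Longrightarrow> run_begins_after k g \<omega> t (j + 1) s'"
proof (induction t j s rule: run_begins_after.induct)
  case (first t s)
  then show ?case using run_begins_after.first run_begins_after.later by blast
next
  case (later t s m j s')
  then show ?case using run_begins_after.later by blast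
qed

lemma success_run_begins_imp_after:
  "success_run_begins k g \<omega> r s \<Longrightarrow> run_begins_after k g \<omega> 0 r s"
proof (induction r s rule: success_run_begins.induct)
  case (first s)
  then show ?case by (rule run_begins_after.first)
next
  case (next_run j s m s')
  then show ?case using run_begins_after_snoc by blast
qed

text \<open>The runs already found act as an accumulator: there are \<open>i\<close> of them, the
  last terminating at \<open>m\<close>. Each run peeled off the front of
  \<open>run_begins_after\<close> is moved into it by one use of \<open>next_run\<close>.\<close>

lemma success_run_begins_append:
  "run_begins_after k g \<omega> t j s' \<Longrightarrow> success_run_begins k g \<omega> i s \<Longrightarrow>
    run_terminates \<omega> s m \<Longrightarrow> t = m + g \<Longrightarrow> success_run_begins k g \<omega> (i + j) s'"
proof (induction t j s' arbitrary: i s m rule: run_begins_after.induct)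
  case (first t s')
  then show ?case using success_run_begins.next_run by blast
next
  case (later t s1 m1 j s')
  have "success_run_begins k g \<omega> (i + 1) s1"
    using later.hyps(1) later.prems success_run_begins.next_run by blast
  from later.IH[OF this later.hyps(2) refl] show ?case by (simp add: add_ac)
qed

lemma success_run_begins_iff_after:
  "success_run_begins k g \<omega> r s \<longleftrightarrow> run_begins_after k g \<omega> 0 r s"
proof
  assume "run_begins_after k g \<omega> 0 r s"
  then show "success_run_begins k g \<omega> r s"
  proof (cases rule: run_begins_after.cases)
    case first
    then show ?thesis using success_run_begins.first by blast
  next
    case (later s1 m j)
    have "success_run_begins k g \<omega> (1 + j) s"
      using success_run_begins_append[OF later(4) success_run_begins.first[OF later(2)] later(3) refl] .
    then show ?thesis using later by simp
  qed
qed (rule success_run_begins_imp_after)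

lemma run_begins_after_less: "run_begins_after k g \<omega> t r s \<Longrightarrow> t < s"
proof (induction t r s rule: run_begins_after.induct)
  case (first t s)
  then show ?case by (simp add: first_long_run_begins_def long_run_begins_def)
next
  case (later t s m j s')
  have "t < s" using later.hyps(1) by (simp add: first_long_run_begins_def long_run_begins_def)
  moreover have "s \<le> m" using later.hyps(2) by (simp add: run_terminates_def)
  ultimately show ?case using later.IH by linarith
qed

section \<open>Runs read trial by trial, and correctness of the automaton\<close>

lemma first_long_run_begins_immediate:
  assumes "\<forall>i\<in>{t + 1..t + k}. \<omega> i"
  shows "first_long_run_begins k \<omega> t s \<longleftrightarrow> s = t + 1"
proof -
  have "first_long_run_begins k \<omega> t (t + 1)"
    using assms unfolding first_long_run_begins_def long_run_begins_def by auto
  then show ?thesis using first_long_run_begins_unique by blast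
qed

text \<open>A long run cannot begin at \<open>t + 1\<close>, since the failure comes too early, nor
  at a later trial up to the failure, since its predecessor would be one of the successes. Hence
  moving the origin to the failure loses nothing.\<close>

lemma first_long_run_begins_skip:
  assumes "\<forall>i\<in>{t + 1..t + c}. \<omega> i" "\<not> \<omega> (t + c + 1)" "c < k"
  shows "first_long_run_begins k \<omega> t s \<longleftrightarrow> first_long_run_begins k \<omega> (t + c + 1) s"
proof -
  have "long_run_begins k \<omega> t s \<longleftrightarrow> long_run_begins k \<omega> (t + c + 1) s" for s
  proof
    assume L: "long_run_begins k \<omega> t s"
    have "\<not> s \<le> t + c + 1"
    proof
      assume le: "s \<le> t + c + 1"
      show False
      proof (cases "s = t + 1")
        case True
        then have "t + c + 1 \<in> {s..<s + k}" using assms(3) by auto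
        then show False using L assms(2) unfolding long_run_begins_def by blast
      next
        case False
        then have "s - 1 \<in> {t + 1..t + c}" "\<not> \<omega> (s - 1)"
          using L le unfolding long_run_begins_def by auto
        then show False using assms(1) by blast
      qed
    qed
    then show "long_run_begins k \<omega> (t + c + 1) s"
      using L unfolding long_run_begins_def by auto
  next
    assume L: "long_run_begins k \<omega> (t + c + 1) s"
    \<comment> \<open>If the run begins right after the new origin, trial \<open>s - 1\<close> is
      the failure itself, so the exceptional clause of \<open>long_run_begins\<close> adds no
      run.\<close>
    then have "\<not> \<omega> (s - 1)" using assms(2) unfolding long_run_begins_def by auto
    then show "long_run_begins k \<omega> t s" using L unfolding long_run_begins_def by auto
  qed
  then show ?thesis unfolding first_long_run_begins_def by simp
qed

lemma run_begins_after_skip: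
  assumes "\<forall>i\<in>{t + 1..t + c}. \<omega> i" "\<not> \<omega> (t + c + 1)" "c < k"
  shows "run_begins_after k g \<omega> t r s \<longleftrightarrow> run_begins_after k g \<omega> (t + c + 1) r s"
proof (cases r)
  case 0
  then show ?thesis using run_begins_after_pos by blast
next
  case (Suc r')
  show ?thesis
  proof (cases "r' = 0")
    case True
    then show ?thesis
      using Suc run_begins_after_1_iff first_long_run_begins_skip[OF assms] by simp
  next
    case False
    then show ?thesis
      using Suc run_begins_after_Suc_iff first_long_run_begins_skip[OF assms] by simp
  qed
qed

text \<open>The meaning of automaton state \<open>c = k\<close>: the current run began at \<open>s0\<close> and has reached trial \<open>a\<close>.\<close>

definition pending :: "nat \<Rightarrow> nat \<Rightarrow> (nat \<Rightarrow> bool) \<Rightarrow> nat \<Rightarrow> nat \<Rightarrow> nat \<Rightarrow> nat \<Rightarrow> bool" where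
  "pending k g \<omega> s0 a r n \<longleftrightarrow>
     (if r = 1 then n = 0
      else \<exists>m s. a \<le> m \<and> run_terminates \<omega> s0 m \<and>
        run_begins_after k g \<omega> (m + g) (r - 1) s \<and> s + k = a + n + 1)"

text \<open>This is the passage from the counting states to state \<open>k\<close>: the
  \<open>k\<close> successes force the first run to begin at \<open>t + 1\<close> and keep it from
  terminating before \<open>t + k\<close>.\<close>

lemma run_begins_after_full:
  assumes "\<forall>i\<in>{t + 1..t + k}. \<omega> i" "1 \<le> r" "1 \<le> k"
  shows "(\<exists>s. run_begins_after k g \<omega> t r s \<and> s + k = t + k + n + 1) \<longleftrightarrow>
     pending k g \<omega> (t + 1) (t + k) r n"
proof (cases "r = 1")
  case True
  then show ?thesis
    using first_long_run_begins_immediate[OF assms(1)] run_begins_after_1_iff[of k g \<omega> t]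
    by (auto simp: pending_def)
next
  case False
  have *: "t + k \<le> m" if "run_terminates \<omega> (t + 1) m" for m
  proof (rule ccontr)
    assume "\<not> t + k \<le> m"
    then have "m + 1 \<in> {t + 1..t + k}" using that by (auto simp: run_terminates_def)
    then show False using that assms(1) unfolding run_terminates_def by blast
  qed
  have r: "r = Suc (r - 1)" "0 < r - 1" using False assms by auto
  have "run_begins_after k g \<omega> t r s \<longleftrightarrow>
      (\<exists>m. run_terminates \<omega> (t + 1) m \<and> run_begins_after k g \<omega> (m + g) (r - 1) s)" for s
    using run_begins_after_Suc_iff[OF r(2), of k g \<omega> t s] r(1)
      first_long_run_begins_immediate[OF assms(1)] by simp
  then show ?thesis using * False unfolding pending_def by auto
qed

text \<open>The two halves need each other, because letters lead from the counting states to state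
  \<open>k\<close> and back. The induction is strong since a gap consumes \<open>g\<close> letters
  at once, and \<open>r\<close> varies since a gap lowers it. The equation
  \<open>s + k = t + c + n + 1\<close> places the \<open>k\<close>-th success of the
  \<open>r\<close>-th run at the last letter without truncated subtraction.\<close>

lemma completes_iff:
  assumes "1 \<le> k" "1 \<le> g" "1 \<le> r"
  shows "(\<forall>t c. c < k \<longrightarrow> (\<forall>i\<in>{t + 1..t + c}. \<omega> i) \<longrightarrow>
      completes k g r c (map \<omega> [t + c + 1..<t + c + n + 1]) =
        (\<exists>s. run_begins_after k g \<omega> t r s \<and> s + k = t + c + n + 1)) \<and>
    (\<forall>s0 a. s0 \<le> a \<longrightarrow> (\<forall>i\<in>{s0..a}. \<omega> i) \<longrightarrow>
      completes k g r k (map \<omega> [a + 1..<a + n + 1]) = pending k g \<omega> s0 a r n)"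
  using assms(3)
proof (induction n arbitrary: r rule: less_induct)
  case (less n)
  note upt_Suc [simp del]
  show ?case
  proof (intro conjI allI impI)
    fix t c
    assume c: "c < k" and S: "\<forall>i\<in>{t + 1..t + c}. \<omega> i"
    show "completes k g r c (map \<omega> [t + c + 1..<t + c + n + 1]) =
        (\<exists>s. run_begins_after k g \<omega> t r s \<and> s + k = t + c + n + 1)"
    proof (cases n)
      case 0
      have "\<not> (\<exists>s. run_begins_after k g \<omega> t r s \<and> s + k = t + c + n + 1)"
      proof
        assume "\<exists>s. run_begins_after k g \<omega> t r s \<and> s + k = t + c + n + 1"
        then obtain s where "run_begins_after k g \<omega> t r s" "s + k = t + c + n + 1" by blast
        with run_begins_after_less[of k g \<omega> t r s] c 0 show False by auto
      qed
      then show ?thesis using 0 c by simp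
    next
      case (Suc n')
      have w: "map \<omega> [t + c + 1..<t + c + n + 1] =
          \<omega> (t + c + 1) # map \<omega> [t + c + 2..<t + c + n + 1]"
        using Suc upt_conv_Cons[of "t + c + 1" "t + c + n + 1"] by simp
      show ?thesis
      proof (cases "\<omega> (t + c + 1)")
        case True
        have S': "\<forall>i\<in>{t + 1..t + Suc c}. \<omega> i"
          using S True by (auto simp: le_Suc_eq)
        show ?thesis
        proof (cases "Suc c < k")
          case True
          have "completes k g r (Suc c) (map \<omega> [t + Suc c + 1..<t + Suc c + n' + 1]) =
            (\<exists>s. run_begins_after k g \<omega> t r s \<and> s + k = t + Suc c + n' + 1)"
            using less.IH[of n' r] less.prems Suc True S' by blast
          then show ?thesis using w c Suc \<open>\<omega> (t + c + 1)\<close> by simp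
        next
          case False
          then have k: "k = Suc c" using c by simp
          have "completes k g r k (map \<omega> [t + k + 1..<t + k + n' + 1]) =
              pending k g \<omega> (t + 1) (t + k) r n'"
            using conjunct2[OF less.IH[of n' r], rule_format, of "t + 1" "t + k"] less.prems Suc S' k
            by simp
          also have "\<dots> = (\<exists>s. run_begins_after k g \<omega> t r s \<and> s + k = t + k + n' + 1)"
            using run_begins_after_full[of t k \<omega> r g n'] S' k less.prems assms by simp
          finally show ?thesis using w c Suc \<open>\<omega> (t + c + 1)\<close> k by simp
        qed
      next
        case False
        have "completes k g r 0 (map \<omega> [(t + c + 1) + 0 + 1..<(t + c + 1) + 0 + n' + 1]) =
            (\<exists>s. run_begins_after k g \<omega> (t + c + 1) r s \<and> s + k = (t + c + 1) + 0 + n' + 1)"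
          using conjunct1[OF less.IH[of n' r], rule_format, of 0 "t + c + 1"] less.prems Suc c
          by simp
        then show ?thesis
          using run_begins_after_skip[OF S False c] w c Suc False by simp
      qed
    qed
  next
    fix s0 a
    assume s0: "s0 \<le> a" and S: "\<forall>i\<in>{s0..a}. \<omega> i"
    show "completes k g r k (map \<omega> [a + 1..<a + n + 1]) = pending k g \<omega> s0 a r n"
    proof (cases n)
      case 0
      have False if "a \<le> m" "run_begins_after k g \<omega> (m + g) (r - 1) s" "s + k = a + 1" for m s
        using run_begins_after_less[OF that(2)] that assms by simp
      then show ?thesis using 0 by (auto simp: pending_def)
    next
      case (Suc n')
      have w: "map \<omega> [a + 1..<a + n + 1] = \<omega> (a + 1) # map \<omega> [a + 2..<a + n + 1]"
        using Suc upt_conv_Cons[of "a + 1" "a + n + 1"] by simp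
      show ?thesis
      proof (cases "r = 1")
        case True
        then show ?thesis using w Suc by (simp add: pending_def)
      next
        case r: False
        show ?thesis
        proof (cases "\<omega> (a + 1)")
          case True
          have S': "\<forall>i\<in>{s0..Suc a}. \<omega> i" using S True by (auto simp: le_Suc_eq)
          \<comment> \<open>Trial \<open>a + 1\<close> is a success, so the run does not terminate
            at \<open>a\<close>.\<close>
          have "a \<le> m \<longleftrightarrow> Suc a \<le> m" if "run_terminates \<omega> s0 m" for m
            using that True unfolding run_terminates_def by (auto simp: le_eq_less_or_eq)
          then have "pending k g \<omega> s0 a r n \<longleftrightarrow> pending k g \<omega> s0 (Suc a) r n'"
            using r Suc unfolding pending_def by auto
          moreover have "completes k g r k (map \<omega> [Suc a + 1..<Suc a + n' + 1]) =
              pending k g \<omega> s0 (Suc a) r n'"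
            using less.IH[of n' r] less.prems Suc s0 S' by (meson le_SucI lessI)
          ultimately show ?thesis using w Suc True r by simp
        next
          case False
          have T: "run_terminates \<omega> s0 a" using s0 S False by (auto simp: run_terminates_def)
          then have Ta: "run_terminates \<omega> s0 m \<longleftrightarrow> m = a" for m
            using run_terminates_unique by blast
          have p: "pending k g \<omega> s0 a r n \<longleftrightarrow>
              (\<exists>s. run_begins_after k g \<omega> (a + g) (r - 1) s \<and> s + k = a + n + 1)"
            using r Ta unfolding pending_def by auto
          have len: "length (map \<omega> [a + 2..<a + n + 1]) = n'" using Suc by simp
          \<comment> \<open>The failure at \<open>a + 1\<close> is the first of the \<open>g\<close>
            excluded trials, so trials \<open>a + 2\<close> to \<open>a + g\<close> remain to be
            dropped. If the word is too short for this, every later run begins beyond its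
            end.\<close>
          show ?thesis
          proof (cases "g - 1 \<le> n'")
            case True
            have "completes k g (r - 1) 0
                (map \<omega> [(a + g) + 0 + 1..<(a + g) + 0 + (n' - (g - 1)) + 1]) =
                (\<exists>s. run_begins_after k g \<omega> (a + g) (r - 1) s \<and>
                  s + k = (a + g) + 0 + (n' - (g - 1)) + 1)"
              using conjunct1[OF less.IH[of "n' - (g - 1)" "r - 1"], rule_format, of 0 "a + g"]
                less.prems Suc r assms by simp
            moreover have "drop (g - 1) (map \<omega> [a + 2..<a + n + 1]) =
                map \<omega> [(a + g) + 0 + 1..<(a + g) + 0 + (n' - (g - 1)) + 1]"
              using True Suc assms by (auto simp: drop_map drop_upt)
            moreover have "a + n + 1 = (a + g) + 0 + (n' - (g - 1)) + 1"
              using True Suc assms by simp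
            ultimately show ?thesis using p w len False r True by simp
          next
            case gn: False
            have False if "run_begins_after k g \<omega> (a + g) (r - 1) s" "s + k = a + n + 1" for s
              using run_begins_after_less[OF that(1)] that gn Suc by simp
            then show ?thesis using p w len False gn r by auto
          qed
        qed
      qed
    qed
  qed
qed

lemma waiting_time_eq_iff:
  assumes "1 \<le> k" "1 \<le> g" "1 \<le> r"
  shows "waiting_time k g r \<omega> = enat n \<longleftrightarrow> completes k g r 0 (map \<omega> [1..<n + 1])"
proof -
  have "completes k g r 0 (map \<omega> [1..<n + 1]) \<longleftrightarrow>
      (\<exists>s. run_begins_after k g \<omega> 0 r s \<and> s + k = n + 1)"
    using conjunct1[OF completes_iff[OF assms, of \<omega> n]] assms
    by (auto dest!: spec[of _ 0] simp del: upt_Suc)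
  also have "\<dots> \<longleftrightarrow> waiting_time k g r \<omega> = enat n"
  proof (cases "\<exists>s. run_begins_after k g \<omega> 0 r s")
    case True
    then obtain s where s: "run_begins_after k g \<omega> 0 r s" by blast
    then have "{s. success_run_begins k g \<omega> r s} = {s}"
      using run_begins_after_unique by (auto simp: success_run_begins_iff_after)
    then have "waiting_time k g r \<omega> = enat (s + k - 1)"
      by (simp add: waiting_time_def)
    \<comment> \<open>Positivity makes \<open>s + k - 1 = n\<close> equivalent to
      \<open>s + k = n + 1\<close>.\<close>
    moreover have "0 < s" using run_begins_after_less[OF s] by simp
    moreover have "\<And>s'. run_begins_after k g \<omega> 0 r s' \<longleftrightarrow> s' = s"
      using s run_begins_after_unique by blast
    ultimately show ?thesis by force
  next
    case False
    \<comment> \<open>The infimum over the empty set is the top element of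
      \<open>enat\<close>.\<close>
    then have "waiting_time k g r \<omega> = \<infinity>"
      by (simp add: waiting_time_def success_run_begins_iff_after top_enat_def)
    then show ?thesis using False by simp
  qed
  finally show ?thesis by simp
qed

section \<open>Probabilities of finite words and the product measure\<close>

definition word_weight :: "real \<Rightarrow> bool list \<Rightarrow> real" where
  "word_weight p w = prod_list (map (\<lambda>b. if b then p else 1 - p) w)"

definition word_prob :: "real \<Rightarrow> nat \<Rightarrow> (bool list \<Rightarrow> bool) \<Rightarrow> real" where
  "word_prob p n P = (\<Sum>w | length w = n. word_weight p w * of_bool (P w))"

lemma finite_words: "finite {w :: bool list. length w = n}"
  using finite_lists_length_eq[of "UNIV :: bool set" n] by simp

lemma word_prob_0: "word_prob p 0 P = of_bool (P [])"
  by (simp add: word_prob_def word_weight_def)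

lemma word_prob_Suc:
  "word_prob p (Suc n) P =
    p * word_prob p n (\<lambda>w. P (True # w)) + (1 - p) * word_prob p n (\<lambda>w. P (False # w))"
proof -
  have eq: "{w. length w = Suc n} = (#) True ` {w. length w = n} \<union> (#) False ` {w. length w = n}"
  proof (rule set_eqI)
    fix w :: "bool list"
    show "w \<in> {w. length w = Suc n} \<longleftrightarrow>
        w \<in> (#) True ` {w. length w = n} \<union> (#) False ` {w. length w = n}"
      by (cases w) (auto simp: image_iff)
  qed
  show ?thesis
    unfolding word_prob_def eq
    by (subst sum.union_disjoint)
       (auto simp: finite_words sum.reindex inj_on_def word_weight_def sum_distrib_left mult_ac
         simp del: sum_mult_of_bool_eq sum_of_bool_mult_eq)
qed

lemma word_prob_const: "word_prob p n (\<lambda>_. b) = of_bool b"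
  by (induction n) (simp_all add: word_prob_0 word_prob_Suc algebra_simps)

text \<open>The weights \<open>p\<close> and \<open>1 - p\<close> of a dropped letter add up to 1;
  this is how the gap trials become free.\<close>

lemma word_prob_drop: "word_prob p (a + n) (\<lambda>w. P (drop a w)) = word_prob p n P"
  by (induction a) (simp_all add: word_prob_Suc algebra_simps)

lemma word_prob_cong:
  "(\<And>w. length w = n \<Longrightarrow> P w = Q w) \<Longrightarrow> word_prob p n P = word_prob p n Q"
  unfolding word_prob_def by (intro sum.cong) auto

lemma prob_space_bernoulli_trials: "prob_space (bernoulli_trials p)"
  unfolding bernoulli_trials_def by (intro prob_space_PiM measure_pmf.prob_space_axioms)

lemma word_event_measure:
  fixes p :: real
  assumes p: "0 \<le> p" "p \<le> 1" and n: "length w = n"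
  defines "A \<equiv> {\<omega> \<in> space (bernoulli_trials p). map \<omega> [1..<n + 1] = w}"
  shows "A \<in> sets (bernoulli_trials p)"
    and "measure (bernoulli_trials p) A = word_weight p w"
proof -
  let ?B = "\<lambda>_::nat. measure_pmf (bernoulli_pmf p)"
  interpret product_prob_space ?B "{1..}" ..
  have "map \<omega> [1..<n + 1] = w \<longleftrightarrow> (\<forall>i\<in>{1..n}. \<omega> i = w ! (i - 1))" for \<omega> :: "nat \<Rightarrow> bool"
  proof -
    have "map \<omega> [1..<n + 1] = w \<longleftrightarrow> (\<forall>i<n. \<omega> (Suc i) = w ! i)"
      using n by (auto simp: list_eq_iff_nth_eq simp del: upt_Suc)
    also have "\<dots> \<longleftrightarrow> (\<forall>i\<in>Suc ` {..<n}. \<omega> i = w ! (i - 1))" by auto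
    also have "Suc ` {..<n} = {1..n}" by (simp add: image_Suc_lessThan)
    finally show ?thesis .
  qed
  \<comment> \<open>Prescribing the first \<open>n\<close> trials gives a cylinder over the
    coordinates 1 to \<open>n\<close>, so its measure is a finite product. The shift
    \<open>i - 1\<close> arises because trials are numbered from 1 and list positions from
    0.\<close>
  then have A: "A = prod_emb {1..} ?B {1..n} (Pi\<^sub>E {1..n} (\<lambda>i. {w ! (i - 1)}))"
    unfolding A_def bernoulli_trials_def
    by (auto simp: prod_emb_def space_PiM PiE_iff extensional_def simp del: upt_Suc)
  show "A \<in> sets (bernoulli_trials p)"
    unfolding A bernoulli_trials_def by (intro sets_PiM_I) auto
  have "measure (bernoulli_trials p) A = (\<Prod>i\<in>{1..n}. measure (?B i) {w ! (i - 1)})"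
    unfolding A bernoulli_trials_def by (rule measure_PiM_emb) auto
  also have "\<dots> = (\<Prod>i\<in>Suc ` {..<n}. measure (?B i) {w ! (i - 1)})"
    by (simp only: image_Suc_lessThan)
  also have "\<dots> = (\<Prod>i<n. if w ! i then p else 1 - p)"
    using p by (subst prod.reindex) (auto simp: measure_pmf_single intro!: prod.cong)
  also have "\<dots> = word_weight p w"
    using n by (simp add: word_weight_def prod.list_conv_set_nth atLeast0LessThan)
  finally show "measure (bernoulli_trials p) A = word_weight p w" .
qed

lemma word_events_measure:
  fixes p :: real
  assumes p: "0 \<le> p" "p \<le> 1"
  defines "A \<equiv> \<lambda>n P. {\<omega> \<in> space (bernoulli_trials p). P (map \<omega> [1..<n + 1])}"
  shows "A n P \<in> sets (bernoulli_trials p)"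
    and "measure (bernoulli_trials p) (A n P) = word_prob p n P"
proof -
  interpret prob_space "bernoulli_trials p" by (rule prob_space_bernoulli_trials)
  let ?W = "{w. length w = n \<and> P w}"
  have fin: "finite ?W" by (rule finite_subset[OF _ finite_words[of n]]) auto
  have eq: "A n P = (\<Union>w\<in>?W. A n (\<lambda>v. v = w))"
    by (auto simp: A_def simp del: upt_Suc)
  have s: "A n (\<lambda>v. v = w) \<in> sets (bernoulli_trials p)" if "w \<in> ?W" for w
    using word_event_measure(1)[OF p, of w n] that by (simp add: A_def)
  show "A n P \<in> sets (bernoulli_trials p)" unfolding eq using fin s by blast
  have "measure (bernoulli_trials p) (A n P) =
      (\<Sum>w\<in>?W. measure (bernoulli_trials p) (A n (\<lambda>v. v = w)))"
    unfolding eq using fin s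
    by (intro finite_measure_finite_Union) (auto simp: disjoint_family_on_def A_def)
  also have "\<dots> = (\<Sum>w\<in>?W. word_weight p w)"
    using word_event_measure(2)[OF p, of _ n] by (intro sum.cong) (auto simp: A_def)
  also have "\<dots> = word_prob p n P"
    unfolding word_prob_def
    by (rule sum.mono_neutral_cong_left) (auto simp: finite_words)
  finally show "measure (bernoulli_trials p) (A n P) = word_prob p n P" .
qed

section \<open>Power series expansion of negative powers of D\<close>

text \<open>The expansion of \<open>1 / (1 - X) ^ (r + 1)\<close>; note the index shift.\<close>

definition fps_neg_power :: "nat \<Rightarrow> real fps" where
  "fps_neg_power r = Abs_fps (\<lambda>n. real ((n + r) choose r))"

lemma fps_neg_power_nth [simp]: "fps_neg_power r $ n = real ((n + r) choose r)"
  by (simp add: fps_neg_power_def)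

lemma fps_neg_power_0: "(1 - fps_X) * fps_neg_power 0 = 1"
proof (rule fps_ext)
  fix n show "((1 - fps_X) * fps_neg_power 0) $ n = (1::real fps) $ n"
    by (cases n) (simp_all add: algebra_simps)
qed

lemma fps_neg_power_Suc: "(1 - fps_X) * fps_neg_power (Suc r) = fps_neg_power r"
proof (rule fps_ext)
  fix n show "((1 - fps_X) * fps_neg_power (Suc r)) $ n = fps_neg_power r $ n"
    by (cases n) (simp_all add: algebra_simps)
qed

lemma fps_neg_power: "(1 - fps_X) ^ Suc r * fps_neg_power r = 1"
proof (induction r)
  case 0
  then show ?case using fps_neg_power_0 by simp
next
  case (Suc r)
  have "(1 - fps_X) ^ Suc (Suc r) * fps_neg_power (Suc r) =
      (1 - fps_X) ^ Suc r * ((1 - fps_X) * fps_neg_power (Suc r))"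
    by (simp only: power_Suc2 mult.assoc)
  then show ?case by (simp only: fps_neg_power_Suc Suc)
qed

text \<open>Both sides are inverse to \<open>(1 - fps_X) ^ Suc r\<close>.\<close>

lemma fps_neg_power_0_power: "fps_neg_power 0 ^ Suc r = fps_neg_power r"
proof -
  have "fps_neg_power 0 ^ Suc r =
      fps_neg_power 0 ^ Suc r * ((1 - fps_X) ^ Suc r * fps_neg_power r)"
    by (simp only: fps_neg_power mult_1_right)
  also have "\<dots> = ((1 - fps_X) * fps_neg_power 0) ^ Suc r * fps_neg_power r"
    by (simp only: power_mult_distrib mult_ac)
  also have "\<dots> = fps_neg_power r" by (simp only: fps_neg_power_0 power_one mult_1_left)
  finally show ?thesis .
qed

text \<open>Since \<open>b\<close> has no constant term, \<open>b ^ i\<close> has no coefficient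
  below \<open>i\<close>, and any cutoff \<open>L\<close> from \<open>n\<close> on is exact. The
  free cutoff later lets two neighbouring coefficients be summed over the same range.\<close>

lemma fps_mult_compose_nth:
  fixes a b f :: "'a::idom fps"
  assumes "b $ 0 = 0" "n \<le> L"
  shows "(a * (f oo b)) $ n = (\<Sum>i\<le>L. f $ i * (a * b ^ i) $ n)"
proof -
  have "(f oo b) $ l = (\<Sum>i\<le>L. f $ i * b ^ i $ l)" if "l \<le> n" for l
    unfolding fps_compose_nth
    by (rule sum.mono_neutral_left)
       (use that assms in \<open>auto simp: startsby_zero_power_prefix\<close>)
  then have "(a * (f oo b)) $ n = (\<Sum>l=0..n. a $ l * (\<Sum>i\<le>L. f $ i * b ^ i $ (n - l)))"
    by (simp add: fps_mult_nth)
  also have "\<dots> = (\<Sum>l=0..n. \<Sum>i\<le>L. f $ i * (a $ l * b ^ i $ (n - l)))"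
    by (simp add: sum_distrib_left mult_ac)
  also have "\<dots> = (\<Sum>i\<le>L. \<Sum>l=0..n. f $ i * (a $ l * b ^ i $ (n - l)))"
    by (rule sum.swap)
  also have "\<dots> = (\<Sum>i\<le>L. f $ i * (a * b ^ i) $ n)"
    by (simp add: sum_distrib_left fps_mult_nth)
  finally show ?thesis .
qed

text \<open>Expanding (1 - Z)^(-(r+1)) gives the first binomial. Every power of Z brings one more
  factor 1 / (1 - X), so together with the \<open>Suc r\<close> factors in front the i-th term
  contains (1 - X)^(-(r+i+1)), whose coefficients are the second binomial.\<close>

lemma fps_trinomial_neg_power:
  fixes c :: real and k r :: nat
  defines "D \<equiv> 1 - fps_X + fps_const c * fps_X ^ Suc k"
  obtains E where "D ^ Suc r * E = 1"
    and "\<And>n L. n \<le> L \<Longrightarrow> E $ n =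
      (\<Sum>i\<le>L. real ((i + r) choose r) * (- c) ^ i *
         (if n < Suc k * i then 0 else real ((n - Suc k * i + (r + i)) choose (r + i))))"
proof
  define U where "U = fps_neg_power 0"
  define Z where "Z = fps_const (- c) * fps_X ^ Suc k * U"
  define E where "E = U ^ Suc r * (fps_neg_power r oo Z)"
  have Z0: "Z $ 0 = 0" by (simp add: Z_def)
  have U: "(1 - fps_X) * U = 1" unfolding U_def by (rule fps_neg_power_0)
  have "(1 - fps_X) * (1 - Z) = (1 - fps_X) - fps_const (- c) * fps_X ^ Suc k * ((1 - fps_X) * U)"
    unfolding Z_def by (simp add: algebra_simps del: fps_const_neg power_Suc)
  also have "\<dots> = 1 - fps_X - fps_const (- c) * fps_X ^ Suc k"
    by (simp only: U mult_1_right)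
  also have "\<dots> = D"
    unfolding D_def by (simp flip: fps_const_neg)
  finally have D: "D = (1 - fps_X) * (1 - Z)" by simp
  \<comment> \<open>Composition with \<open>Z\<close> is a ring homomorphism because
    \<open>Z\<close> has no constant term; it carries the identity \<open>fps_neg_power\<close> from
    X to \<open>Z\<close>.\<close>
  have "(1 - Z) ^ Suc r * (fps_neg_power r oo Z) = ((1 - fps_X) ^ Suc r * fps_neg_power r) oo Z"
    using Z0 by (simp only: fps_compose_mult_distrib fps_compose_power[symmetric]
      fps_compose_sub_distrib fps_compose_1 fps_X_fps_compose_startby0)
  then have *: "(1 - Z) ^ Suc r * (fps_neg_power r oo Z) = 1"
    by (simp only: fps_neg_power fps_compose_1)
  have "D ^ Suc r * E = ((1 - fps_X) * U) ^ Suc r * ((1 - Z) ^ Suc r * (fps_neg_power r oo Z))"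
    unfolding D E_def by (simp only: power_mult_distrib mult_ac)
  then show "D ^ Suc r * E = 1" by (simp only: U * power_one mult_1_left)
  show "E $ n = (\<Sum>i\<le>L. real ((i + r) choose r) * (- c) ^ i *
         (if n < Suc k * i then 0 else real ((n - Suc k * i + (r + i)) choose (r + i))))"
    if "n \<le> L" for n L
  proof -
    have "U ^ Suc r * Z ^ i = fps_const ((- c) ^ i) * (fps_X ^ (Suc k * i) * fps_neg_power (r + i))"
      for i
    proof -
      have "U ^ Suc r * Z ^ i = fps_const (- c) ^ i * ((fps_X ^ Suc k) ^ i * (U ^ Suc r * U ^ i))"
        unfolding Z_def by (simp only: power_mult_distrib mult_ac)
      also have "U ^ Suc r * U ^ i = U ^ Suc (r + i)" by (simp add: power_add)
      also have "\<dots> = fps_neg_power (r + i)" unfolding U_def by (rule fps_neg_power_0_power)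
      finally show ?thesis by (simp only: fps_const_power power_mult)
    qed
    then have "(U ^ Suc r * Z ^ i) $ n = (- c) ^ i *
         (if n < Suc k * i then 0 else real ((n - Suc k * i + (r + i)) choose (r + i)))" for i
      by (simp only: fps_mult_left_const_nth fps_X_power_mult_nth fps_neg_power_nth)
    then show ?thesis
      unfolding E_def fps_mult_compose_nth[OF Z0 that] by (simp only: fps_neg_power_nth mult.assoc)
  qed
qed

section \<open>The law of the waiting time in terms of words\<close>

lemma waiting_time_measurable:
  assumes "1 \<le> k" "1 \<le> g" "1 \<le> r" "0 \<le> p" "p \<le> 1"
  shows "waiting_time k g r \<in> measurable (bernoulli_trials p) (count_space UNIV)"
proof -
  let ?M = "bernoulli_trials p"
  have fin: "waiting_time k g r -` {enat n} \<inter> space ?M \<in> sets ?M" for n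
  proof -
    have "waiting_time k g r -` {enat n} \<inter> space ?M =
        {\<omega> \<in> space ?M. completes k g r 0 (map \<omega> [1..<n + 1])}"
      using waiting_time_eq_iff[OF assms(1-3), of _ n] by blast
    then show ?thesis using word_events_measure(1)[OF assms(4,5)] by simp
  qed
  \<comment> \<open>As \<open>enat\<close> is countable, preimages of points suffice, and the one of
    infinity is the complement of all the others.\<close>
  have "waiting_time k g r -` {\<infinity>} \<inter> space ?M =
      space ?M - (\<Union>n. waiting_time k g r -` {enat n} \<inter> space ?M)"
    using not_infinity_eq by fastforce
  also have "\<dots> \<in> sets ?M"
    using fin by (intro sets.Diff sets.top sets.countable_UN) auto
  finally have "waiting_time k g r -` {\<infinity>} \<inter> space ?M \<in> sets ?M" .
  then have "waiting_time k g r -` {a} \<inter> space ?M \<in> sets ?M" for a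
    using fin by (cases a) auto
  then show ?thesis by (simp add: measurable_count_space_eq2_countable)
qed

lemma measure_NB_II:
  assumes "1 \<le> k" "1 \<le> g" "1 \<le> r" "0 \<le> p" "p \<le> 1"
  shows "measure (NB_II p k g r) {enat n} = word_prob p n (completes k g r 0)"
proof -
  have "measure (NB_II p k g r) {enat n} = measure (bernoulli_trials p)
      (waiting_time k g r -` {enat n} \<inter> space (bernoulli_trials p))"
    unfolding NB_II_def by (rule measure_distr[OF waiting_time_measurable[OF assms]]) simp
  also have "waiting_time k g r -` {enat n} \<inter> space (bernoulli_trials p) =
      {\<omega> \<in> space (bernoulli_trials p). completes k g r 0 (map \<omega> [1..<n + 1])}"
    using waiting_time_eq_iff[OF assms(1-3), of _ n] by blast
  finally show ?thesis using word_events_measure(2)[OF assms(4,5)] by simp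
qed

section \<open>Linear equations between the generating functions\<close>

definition completion_fps :: "real \<Rightarrow> nat \<Rightarrow> nat \<Rightarrow> nat \<Rightarrow> nat \<Rightarrow> real fps" where
  "completion_fps p k g r c = Abs_fps (\<lambda>n. word_prob p n (completes k g r c))"

lemma completion_fps_nth [simp]:
  "completion_fps p k g r c $ n = word_prob p n (completes k g r c)"
  by (simp add: completion_fps_def)

lemma completion_fps_step:
  assumes "c < k"
  shows "completion_fps p k g r c =
    fps_X * (fps_const p * completion_fps p k g r (Suc c) +
      fps_const (1 - p) * completion_fps p k g r 0)"
proof (rule fps_ext)
  fix n show "completion_fps p k g r c $ n =
    (fps_X * (fps_const p * completion_fps p k g r (Suc c) +
      fps_const (1 - p) * completion_fps p k g r 0)) $ n"
    using assms by (cases n) (simp_all add: word_prob_0 word_prob_Suc)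
qed

lemma completion_fps_last: "completion_fps p k g 1 k = 1"
proof (rule fps_ext)
  fix n show "completion_fps p k g 1 k $ n = 1 $ n"
    by (cases n) (simp_all add: word_prob_0 word_prob_Suc word_prob_const)
qed

text \<open>In state \<open>k\<close> a success loops, which yields the factor 1 - p X on the left.
  The terminating failure supplies one X and the \<open>g - 1\<close> skipped trials, of total
  weight 1, the others.\<close>

lemma completion_fps_gap:
  assumes "1 \<le> g" "1 \<le> r"
  shows "(1 - fps_const p * fps_X) * completion_fps p k g (Suc r) k =
    fps_const (1 - p) * fps_X ^ g * completion_fps p k g r 0"
proof -
  have gap: "word_prob p n (\<lambda>w. g - 1 \<le> length w \<and> completes k g r 0 (drop (g - 1) w)) =
      (if n < g - 1 then 0 else word_prob p (n - (g - 1)) (completes k g r 0))" for n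
  proof -
    have "word_prob p n (\<lambda>w. g - 1 \<le> length w \<and> completes k g r 0 (drop (g - 1) w)) =
        word_prob p n (\<lambda>w. g - 1 \<le> n \<and> completes k g r 0 (drop (g - 1) w))"
      by (rule word_prob_cong) simp
    then show ?thesis
      using word_prob_drop[of p "g - 1" "n - (g - 1)"] word_prob_const[of p n False] by auto
  qed
  have "completion_fps p k g (Suc r) k =
    fps_X * (fps_const p * completion_fps p k g (Suc r) k +
      fps_const (1 - p) * (fps_X ^ (g - 1) * completion_fps p k g r 0))"
  proof (rule fps_ext)
    fix n show "completion_fps p k g (Suc r) k $ n =
      (fps_X * (fps_const p * completion_fps p k g (Suc r) k +
        fps_const (1 - p) * (fps_X ^ (g - 1) * completion_fps p k g r 0))) $ n"
      using assms gap
      by (cases n) (simp_all add: word_prob_0 word_prob_Suc fps_X_power_mult_nth)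
  qed
  moreover have "fps_X * fps_X ^ (g - 1) = (fps_X ^ g :: real fps)"
    using assms by (cases g) auto
  ultimately have "completion_fps p k g (Suc r) k =
      fps_const p * fps_X * completion_fps p k g (Suc r) k +
      fps_const (1 - p) * fps_X ^ g * completion_fps p k g r 0"
    by (metis (no_types, lifting) distrib_left mult.assoc mult.left_commute)
  then show ?thesis by (simp add: algebra_simps)
qed

text \<open>Unrolling \<open>completion_fps_step\<close> from state 0 sums the returns after fewer
  than \<open>c\<close> successes as Q (1 - P^c) / (1 - P). Both sides are multiplied by 1 - P to
  avoid the division.\<close>

lemma completion_fps_count:
  fixes p :: real
  defines "P \<equiv> fps_const p * fps_X" and "Q \<equiv> fps_const (1 - p) * fps_X"
  assumes "c \<le> k"
  shows "(1 - P) * completion_fps p k g r 0 =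
    (1 - P) * P ^ c * completion_fps p k g r c + Q * (1 - P ^ c) * completion_fps p k g r 0"
  using assms(3)
proof (induction c)
  case 0
  then show ?case by simp
next
  case (Suc c)
  have "completion_fps p k g r c =
      P * completion_fps p k g r (Suc c) + Q * completion_fps p k g r 0"
    using completion_fps_step[of c k p g r] Suc.prems
    by (simp add: P_def Q_def algebra_simps)
  then have "(1 - P) * completion_fps p k g r 0 =
    (1 - P) * P ^ c * (P * completion_fps p k g r (Suc c) + Q * completion_fps p k g r 0) +
    Q * (1 - P ^ c) * completion_fps p k g r 0"
    using Suc by simp
  then show ?case by (simp add: algebra_simps)
qed

text \<open>This is the case \<open>c = k\<close> of the count, solved for state 0. The factor 1 - p
  X stays attached to state \<open>k\<close>, where \<open>completion_fps_gap\<close> can absorb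
  it.\<close>

lemma completion_fps_full:
  fixes p :: real
  shows "(1 - fps_X + fps_const ((1 - p) * p ^ k) * fps_X ^ Suc k) * completion_fps p k g r 0 =
    (fps_const p * fps_X) ^ k * ((1 - fps_const p * fps_X) * completion_fps p k g r k)"
proof -
  define P where "P = fps_const p * fps_X"
  define Q where "Q = fps_const (1 - p) * fps_X"
  have PQ: "P + Q = fps_X" by (simp add: P_def Q_def flip: distrib_right)
  have "fps_const ((1 - p) * p ^ k) * fps_X ^ Suc k = Q * P ^ k"
    by (simp add: P_def Q_def power_mult_distrib fps_const_power mult_ac flip: fps_const_mult)
  then have D: "1 - fps_X + fps_const ((1 - p) * p ^ k) * fps_X ^ Suc k =
      1 - P - Q * (1 - P ^ k)"
    unfolding PQ[symmetric] by (simp add: algebra_simps)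
  have "(1 - P) * completion_fps p k g r 0 =
      (1 - P) * P ^ k * completion_fps p k g r k + Q * (1 - P ^ k) * completion_fps p k g r 0"
    unfolding P_def Q_def by (rule completion_fps_count[OF order_refl])
  then show ?thesis
    unfolding D P_def[symmetric] by (simp add: algebra_simps)
qed

section \<open>Solution of the equations and extraction of coefficients\<close>

lemma completion_fps_closed_form:
  assumes "1 \<le> g"
  shows "(1 - fps_X + fps_const ((1 - p) * p ^ k) * fps_X ^ Suc k) ^ Suc r *
      completion_fps p k g (Suc r) 0 =
    fps_const (p ^ (k * Suc r) * (1 - p) ^ r) *
      (fps_X ^ (k * Suc r + g * r) * (1 - fps_const p * fps_X))"
proof -
  define D where "D = 1 - fps_X + fps_const ((1 - p) * p ^ k) * fps_X ^ Suc k"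
  define P where "P = fps_const p * fps_X"
  define G where "G = fps_const (1 - p) * fps_X ^ g"
  have D: "D * completion_fps p k g r 0 = P ^ k * ((1 - P) * completion_fps p k g r k)" for r
    unfolding D_def P_def by (rule completion_fps_full)
  have "D ^ Suc r * completion_fps p k g (Suc r) 0 = P ^ k * (1 - P) * (P ^ k * G) ^ r" for r
  proof (induction r)
    case 0
    then show ?case using D[of 1] completion_fps_last[of p k g] by simp
  next
    case (Suc r)
    have "D ^ Suc (Suc r) * completion_fps p k g (Suc (Suc r)) 0 =
        D ^ Suc r * (D * completion_fps p k g (Suc (Suc r)) 0)"
      by (simp only: power_Suc2 mult.assoc)
    \<comment> \<open>The factor 1 - P produced by \<open>D\<close> is consumed by the gap equation,
      so an additional run costs exactly \<open>P ^ k * G\<close>.\<close>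
    also have "\<dots> = D ^ Suc r * (P ^ k * (G * completion_fps p k g (Suc r) 0))"
      unfolding D unfolding P_def G_def using completion_fps_gap[OF assms, of "Suc r" p k] by simp
    also have "\<dots> = P ^ k * G * (D ^ Suc r * completion_fps p k g (Suc r) 0)"
      by (simp only: mult_ac)
    also have "\<dots> = P ^ k * (1 - P) * (P ^ k * G) ^ Suc r"
      unfolding Suc by (simp only: power_Suc mult_ac)
    finally show ?case .
  qed
  moreover have "P ^ k * (1 - P) * (P ^ k * G) ^ r =
      (P ^ k) ^ Suc r * fps_const (1 - p) ^ r * (fps_X ^ g) ^ r * (1 - P)"
    unfolding G_def by (simp add: power_mult_distrib mult_ac)
  moreover have "(P ^ k) ^ Suc r = fps_const p ^ (k * Suc r) * fps_X ^ (k * Suc r)"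
    unfolding P_def by (simp only: power_mult[symmetric] power_mult_distrib)
  ultimately show ?thesis
    unfolding D_def[symmetric] P_def[symmetric]
    by (simp only: power_add power_mult[symmetric] fps_const_power fps_const_mult[symmetric] mult_ac)
qed

text \<open>Here \<open>s\<close> is the least possible waiting time: \<open>Suc r\<close> runs of
  length \<open>k\<close> separated by \<open>r\<close> gaps of length \<open>g\<close>. The sum
  stops at \<open>(n - s) div Suc k\<close> because beyond it both upper entries are smaller than
  \<open>r + i\<close>.\<close>

lemma completion_prob:
  fixes p :: real and k r :: nat
  assumes "1 \<le> g"
  defines "s \<equiv> k * Suc r + g * r"
  shows "word_prob p n (completes k g (Suc r) 0) =
    (if n < s then 0
     else p ^ (k * Suc r) * (1 - p) ^ r *
       (\<Sum>i\<le>(n - s) div Suc k. real ((i + r) choose r) * (- ((1 - p) * p ^ k)) ^ i *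
          (real (binom (int (n - s) + int r - int (k * i)) (r + i)) -
           p * real (binom (int (n - s) + int r - int (k * i) - 1) (r + i)))))"
proof -
  define c where "c = (1 - p) * p ^ k"
  obtain E where E: "(1 - fps_X + fps_const c * fps_X ^ Suc k) ^ Suc r * E = 1"
    and E_nth: "\<And>n L. n \<le> L \<Longrightarrow> E $ n =
      (\<Sum>i\<le>L. real ((i + r) choose r) * (- c) ^ i *
         (if n < Suc k * i then 0 else real ((n - Suc k * i + (r + i)) choose (r + i))))"
    using fps_trinomial_neg_power[of c k r] by blast
  \<comment> \<open>With integer upper entry n + r - k i, the case split on
    \<open>n < Suc k * i\<close> becomes the convention of \<open>binom\<close>: that entry is below
    r + i exactly in the vanishing case.\<close>
  have E_binom: "E $ n =
      (\<Sum>i\<le>L. real ((i + r) choose r) * (- c) ^ i *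
         real (binom (int n + int r - int (k * i)) (r + i)))" if "n \<le> L" for n L
  proof -
    have "(if n < Suc k * i then 0 else real ((n - Suc k * i + (r + i)) choose (r + i))) =
        real (binom (int n + int r - int (k * i)) (r + i))" for i
    proof (cases "n < Suc k * i")
      case True
      then have "int n < int (Suc k * i)" by linarith
      then show ?thesis using True by (simp add: binom_def algebra_simps)
    next
      case False
      then obtain d where d: "n = Suc k * i + d" by (metis le_iff_add not_less)
      then have "int n + int r - int (k * i) = int (d + (r + i))" by (simp add: algebra_simps)
      then have "binom (int n + int r - int (k * i)) (r + i) = (d + (r + i)) choose (r + i)"
        by (simp add: binom_def del: of_nat_add)
      moreover have "n - Suc k * i = d" using d by simp
      ultimately show ?thesis using False by simp
    qed
    then show ?thesis using E_nth[OF that] by simp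
  qed
  have "completion_fps p k g (Suc r) 0 =
      ((1 - fps_X + fps_const c * fps_X ^ Suc k) ^ Suc r * E) * completion_fps p k g (Suc r) 0"
    by (simp only: E mult_1_left)
  also have "\<dots> = E * ((1 - fps_X + fps_const c * fps_X ^ Suc k) ^ Suc r *
      completion_fps p k g (Suc r) 0)"
    by (simp only: mult_ac)
  also have "\<dots> = fps_const (p ^ (k * Suc r) * (1 - p) ^ r) *
      (fps_X ^ s * (E - fps_X * (fps_const p * E)))"
    unfolding c_def completion_fps_closed_form[OF assms(1)] s_def
    by (simp add: algebra_simps del: fps_const_mult)
  finally have F: "completion_fps p k g (Suc r) 0 = \<dots>" .
  have nth: "word_prob p n (completes k g (Suc r) 0) =
      (if n < s then 0 else p ^ (k * Suc r) * (1 - p) ^ r *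
        (E $ (n - s) - (if n - s = 0 then 0 else p * E $ (n - s - 1))))"
    unfolding completion_fps_nth[symmetric] F
    by (simp add: fps_X_power_mult_nth del: completion_fps_nth)
  define N where "N = n - s"
  let ?T = "\<lambda>i. real ((i + r) choose r) * (- c) ^ i *
    (real (binom (int N + int r - int (k * i)) (r + i)) -
     p * real (binom (int N + int r - int (k * i) - 1) (r + i)))"
  \<comment> \<open>At \<open>N = 0\<close> there is no preceding coefficient, and the right-hand
    side must vanish too. For \<open>r = 0\<close> this is where binom(-1, 0) = 0 matters.\<close>
  have shifted: "(if N = 0 then 0 else p * E $ (N - 1)) =
      p * (\<Sum>i\<le>N. real ((i + r) choose r) * (- c) ^ i *
        real (binom (int N + int r - int (k * i) - 1) (r + i)))"
  proof (cases "N = 0")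
    case True
    then show ?thesis by (simp add: binom_def)
  next
    case False
    then have "int (N - 1) + int r - int (k * i) = int N + int r - int (k * i) - 1" for i
      by simp
    then have "E $ (N - 1) = (\<Sum>i\<le>N. real ((i + r) choose r) * (- c) ^ i *
        real (binom (int N + int r - int (k * i) - 1) (r + i)))"
      using E_binom[of "N - 1" N] by (simp only: diff_le_self)
    then show ?thesis using False by simp
  qed
  have "E $ N - (if N = 0 then 0 else p * E $ (N - 1)) = (\<Sum>i\<le>N. ?T i)"
    unfolding shifted unfolding E_binom[OF order_refl]
    by (simp add: sum_distrib_left sum_subtractf algebra_simps)
  also have "\<dots> = (\<Sum>i\<le>N div Suc k. ?T i)"
  proof (rule sum.mono_neutral_right)
    show "\<forall>i\<in>{..N} - {..N div Suc k}. ?T i = 0"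
    proof
      fix i assume "i \<in> {..N} - {..N div Suc k}"
      then have "N div Suc k < i" by auto
      then have "N < Suc k * i" by (subst mult.commute) (simp only: div_less_iff_less_mult zero_less_Suc)
      then have "int N < int (Suc k * i)" by linarith
      then show "?T i = 0" by (simp add: binom_def algebra_simps)
    qed
  qed (auto intro: order_trans[OF _ div_le_dividend])
  finally show ?thesis
    unfolding nth c_def[symmetric] N_def[symmetric] by (simp only:)
qed

theorem mainTheorem10:
  fixes k g r n :: nat and p q :: real and \<nu> :: int
    and M :: "'a measure" and Y :: "'a \<Rightarrow> enat"
  assumes "k \<ge> 1" and "g \<ge> 1" and "r \<ge> 1" and "n \<ge> 1"
    and "0 < p" and "p < 1" and "q = 1 - p"
    and "\<nu> = int n - (int r - 1) * (int g - 1)"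
    and "prob_space M"
    and "Y \<in> measurable M (count_space UNIV)"
    and "distr M (count_space UNIV) Y = NB_II p k g r"
  shows "measure M {x \<in> space M. Y x = enat n} =
    (\<Sum>m = r..nat \<lfloor>real_of_int (\<nu> + 1) / real (k + 1)\<rfloor>.
       (-1) ^ (m - r) * real ((m - 1) choose (r - 1)) * p ^ (m * k) * q ^ (m - 1) *
       (real (binom (\<nu> - int (m * k)) (m - 1))
        - p * real (binom (\<nu> - int (m * k) - 1) (m - 1))))"
    (is "_ = sum ?f _")
proof -
  have "{x \<in> space M. Y x = enat n} = Y -` {enat n} \<inter> space M" by auto
  then have "measure M {x \<in> space M. Y x = enat n} = measure (NB_II p k g r) {enat n}"
    using measure_distr[OF assms(10), of "{enat n}"] assms(11) by simp
  also have "\<dots> = word_prob p n (completes k g r 0)"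
    using assms by (intro measure_NB_II) auto
  finally have prob: "measure M {x \<in> space M. Y x = enat n} = \<dots>" .
  obtain r' where r: "r = Suc r'" using assms(3) by (cases r) auto
  define s where "s = k * Suc r' + g * r'"
  \<comment> \<open>This identity is stated in the integers, as \<open>n < s\<close> is still
    possible. It explains \<open>\<nu>\<close>: for \<open>n\<close> at least \<open>s\<close>,
    dividing by \<open>k + 1\<close> gives the upper limit r + (n - s) div (k + 1).\<close>
  have nu: "\<nu> + 1 = int n - int s + int (Suc k) * int r"
    unfolding assms(8) r s_def by (simp add: algebra_simps)
  have fl: "\<lfloor>real_of_int (\<nu> + 1) / real (k + 1)\<rfloor> = (\<nu> + 1) div int (Suc k)"
    using floor_divide_of_int_eq[of "\<nu> + 1" "int (Suc k)", where ?'a = real] by simp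
  show ?thesis
  proof (cases "n < s")
    case True
    then have "\<nu> + 1 < int r * int (Suc k)" using nu by (simp add: mult.commute)
    moreover have "(\<nu> + 1) div int (Suc k) * int (Suc k) \<le> \<nu> + 1"
      by (simp only: minus_mod_eq_div_mult[symmetric]) simp
    ultimately have "(\<nu> + 1) div int (Suc k) < int r"
      by (meson le_less_trans mult_right_less_imp_less of_nat_0_le_iff)
    \<comment> \<open>A negative quotient is sent to 0 by \<open>nat\<close>, which is still below
      \<open>r\<close>; so the range of summation is empty.\<close>
    then have "nat ((\<nu> + 1) div int (Suc k)) < r" using r by linarith
    then show ?thesis
      using True completion_prob[OF assms(2), of p n k r'] unfolding prob fl r s_def by simp
  next
    case False
    define N where "N = n - s"
    have nuN: "\<nu> + 1 = int N + int r * int (Suc k)"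
      using nu False unfolding N_def by (simp add: mult.commute)
    then have "(\<nu> + 1) div int (Suc k) = int (r + N div Suc k)"
      by (simp add: zdiv_int)
    then have upper: "nat ((\<nu> + 1) div int (Suc k)) = r + N div Suc k"
      by (simp only: nat_int)
    have "word_prob p n (completes k g r 0) =
       (\<Sum>i\<le>N div Suc k. p ^ (k * Suc r') * q ^ r' * (real ((i + r') choose r') *
          (- (q * p ^ k)) ^ i * (real (binom (int N + int r' - int (k * i)) (r' + i)) -
           p * real (binom (int N + int r' - int (k * i) - 1) (r' + i)))))"
      using completion_prob[OF assms(2), of p n k r'] False
      unfolding s_def[symmetric] N_def[symmetric] r assms(7) by (simp add: sum_distrib_left)
    \<comment> \<open>The power \<open>i\<close> of Z corresponds to \<open>m = i + r\<close>: the
      \<open>r\<close> runs supply p^(k r) q^(r-1), and each factor of Z supplies another - q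
      p^k.\<close>
    also have "\<dots> = (\<Sum>i\<le>N div Suc k. ?f (i + r))"
    proof (rule sum.cong[OF refl])
      fix i
      have "int N + int r' - int (k * i) = \<nu> - int ((i + r) * k)"
        using nuN unfolding r by (simp add: algebra_simps)
      moreover have "p ^ (k * Suc r') * q ^ r' * (- (q * p ^ k)) ^ i =
          (- 1) ^ i * p ^ ((i + r) * k) * q ^ (i + r')"
      proof -
        have "(- (q * p ^ k)) ^ i = (- 1) ^ i * (q ^ i * p ^ (k * i))"
          by (subst power_minus) (simp only: power_mult_distrib power_mult)
        moreover have "p ^ ((i + r) * k) = p ^ (k * i) * p ^ (k * Suc r')"
          unfolding r by (simp only: power_add[symmetric] algebra_simps)
        ultimately show ?thesis by (simp only: power_add mult_ac)
      qed
      ultimately show "p ^ (k * Suc r') * q ^ r' * (real ((i + r') choose r') *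
          (- (q * p ^ k)) ^ i * (real (binom (int N + int r' - int (k * i)) (r' + i)) -
           p * real (binom (int N + int r' - int (k * i) - 1) (r' + i)))) = ?f (i + r)"
        using r by (simp add: mult_ac add_ac del: mult_Suc mult_Suc_right)
    qed
    also have "\<dots> = (\<Sum>m = r..r + N div Suc k. ?f m)"
      by (rule sum.reindex_bij_witness[of _ "\<lambda>m. m - r" "\<lambda>i. i + r"]) auto
    finally show ?thesis unfolding prob fl upper .
  qed
qed

end
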